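(* Every function $f\in\mathcal{M}$ has a $v$-asymptotic expansion in $\mathcal{M}$. More precisely, let $\mathcal{C}$ be a complex vector subspace of $\mathcal{M}$ which is maximal in $\mathcal{C}_v$. Then every $f\in\mathcal{M}$ has a unique $v$-asymptotic expansion $$f(x)\leadsto\sum_{n=0}^\infty\frac{\varphi_n(x)}{x^{r_n}},\qquad x\to\infty,$$ with all coefficients $\varphi_n$ in $\mathcal{C}$; that is, there is exactly one $v$-asymptotic series (exactly one pair of sequences $(\varphi_n)_{n\ge0}$, $(r_n)_{n\ge0}$) with all $\varphi_n\in\mathcal{C}$ which is a $v$-asymptotic expansion of $f$.
   Context: $G_\infty(\mathbb{R},\mathbb{C})$ is the ring (pointwise operations) of germs at $+\infty$ of complex valued functions defined on a subset of $\mathbb{R}$ containing some interval $(n,\infty)$, $n\in\mathbb{N}$ (two functions are identified if they agree for all sufficiently large $x$). $\mathcal{M}$ is the set of $f\in G_\infty(\mathbb{R},\mathbb{C})$ with $f(x)=O(x^n)$ as $x\to\infty$ for some $n\in\mathbb{N}$ (functions of moderate growth); $\mathcal{N}$ is the set of $f$ with $f(x)=O(1/x^n)$ for all $n\in\mathbb{N}$. For $f\in\mathcal{M}$, $v(f)=\sup\{r\in\mathbb{R} : f(x)=O(1/x^r)\text{ as }x\to\infty\}\in\mathbb{R}\cup\{\infty\}$. $\mathcal{C}_v=\{f\in\mathcal{M}: v(f)=0\}$. A complex vector subspace $\mathcal{C}$ of $\mathcal{M}$ is maximal in $\mathcal{C}_v$ if $\mathbb{C}\subset\mathcal{C}\subset\mathcal{C}_v\cup\{0\}$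 (with $\mathbb{C}$ the constant functions) and there is no vector subspace $\mathcal{K}$ of $\mathcal{M}$ with $\mathcal{C}\subsetneqq\mathcal{K}\subset\mathcal{C}_v\cup\{0\}$. A set $\Phi\subset\mathcal{M}$ is linearly $v$-independent over $\mathbb{C}$ if $\mathrm{Span}_{\mathbb{C}}(\Phi)\subset\mathcal{C}_v\cup\{0\}$. A $v$-asymptotic series (in canonical form) is a formal series $\sum_{n=0}^\infty\varphi_n(x)/x^{r_n}$ given by sequences $\varphi_n\in\mathcal{M}$ and $r_n\in\mathbb{R}\cup\{\infty\}$ such that: (a) the set $\{\varphi_n : n\ge0\}$ is linearly $v$-independent over $\mathbb{C}$; (b) $r_n=\infty$ if and only if $\varphi_n=0$, if and only if $\varphi_m=0$ for all $m\ge n$; and $(r_n)$ restricted to $\{n:\varphi_n\ne0\}$ is a strictly increasing (finite or infinite, bounded or unbounded) sequence in $\mathbb{R}$. By convention $0/x^\infty=0$. The series is a $v$-asymptotic expansion of $f\in\mathcal{M}$, written $f(x)\leadsto\sum_{n=0}^\infty\varphi_n(x)/x^{r_n}$, if for every $n\ge0$ with $\varphi_n\neq0$ one has $f(x)-\sum_{k=0}^n\varphi_k(x)/x^{r_k}=o(1/x^{r_n})$ as $x\to\infty$, and for every $n\ge 0$ with $\varphi_n=0$ one has $f(x)-\sum_{k=0}^{n-1}\varphi_k(x)/x^{r_k}\in\mathcal{N}$. *)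

theory Defs
  imports Complex_Main "HOL-Library.Extended_Real" "HOL-Library.Landau_Symbols"
begin

(* A function defined only on a subset of the reals that contains some interval (n, \<infinity>) agrees
   near +\<infinity> with a total function, so germs of partial functions and germs of total functions
   are the same thing. *)
quotient_type germ = "real \<Rightarrow> complex" /
  "\<lambda>f g. eventually (\<lambda>x. f x = g x) at_top"
proof (rule equivpI)
  show "reflp (\<lambda>f g :: real \<Rightarrow> complex. \<forall>\<^sub>F x in at_top. f x = g x)"
    by (auto intro: reflpI)
  show "symp (\<lambda>f g :: real \<Rightarrow> complex. \<forall>\<^sub>F x in at_top. f x = g x)"
    by (rule sympI) (auto elim: eventually_mono)
  show "transp (\<lambda>f g :: real \<Rightarrow> complex. \<forall>\<^sub>F x in at_top. f x = g x)"
    by (rule transpI) (auto elim: eventually_elim2)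
qed

instantiation germ :: comm_ring_1
begin

lift_definition zero_germ :: germ is "\<lambda>x. 0" .
lift_definition one_germ :: germ is "\<lambda>x. 1" .
lift_definition plus_germ :: "germ \<Rightarrow> germ \<Rightarrow> germ" is "\<lambda>f g x. f x + g x"
  by (auto elim: eventually_elim2)
lift_definition minus_germ :: "germ \<Rightarrow> germ \<Rightarrow> germ" is "\<lambda>f g x. f x - g x"
  by (auto elim: eventually_elim2)
lift_definition uminus_germ :: "germ \<Rightarrow> germ" is "\<lambda>f x. - f x"
  by (auto elim: eventually_mono)
lift_definition times_germ :: "germ \<Rightarrow> germ \<Rightarrow> germ" is "\<lambda>f g x. f x * g x"
  by (auto elim: eventually_elim2)

instance
  by standard (transfer, simp add: algebra_simps eventually_False)+

end

lift_definition germ_const :: "complex \<Rightarrow> germ" is "\<lambda>c x. c" .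

definition germ_scale :: "complex \<Rightarrow> germ \<Rightarrow> germ" where
  "germ_scale c f = germ_const c * f"

interpretation germ_vs: vector_space germ_scale
  unfolding germ_scale_def by unfold_locales (transfer, simp add: algebra_simps)+

lift_definition germ_bigo :: "germ \<Rightarrow> (real \<Rightarrow> real) \<Rightarrow> bool" is
  "\<lambda>f g. f \<in> O[at_top](\<lambda>x. complex_of_real (g x))"
  by (intro ext landau_o.big.in_cong)

lift_definition germ_smallo :: "germ \<Rightarrow> (real \<Rightarrow> real) \<Rightarrow> bool" is
  "\<lambda>f g. f \<in> o[at_top](\<lambda>x. complex_of_real (g x))"
  by (intro ext landau_o.small.in_cong)

definition moderate :: "germ set" where
  "moderate = {f. \<exists>n::nat. germ_bigo f (\<lambda>x. x ^ n)}"

definition negligible :: "germ set" where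
  "negligible = {f. \<forall>n::nat. germ_bigo f (\<lambda>x. 1 / x ^ n)}"

(* Only meaningful on moderate germs, where the set of exponents is nonempty. *)
definition val_v :: "germ \<Rightarrow> ereal" where
  "val_v f = Sup (ereal ` {r. germ_bigo f (\<lambda>x. 1 / x powr r)})"

definition C_v :: "germ set" where
  "C_v = {f \<in> moderate. val_v f = 0}"

definition maximal_in_C_v :: "germ set \<Rightarrow> bool" where
  "maximal_in_C_v C \<longleftrightarrow>
     germ_vs.subspace C \<and> C \<subseteq> moderate \<and>
     range germ_const \<subseteq> C \<and> C \<subseteq> C_v \<union> {0} \<and>
     \<not> (\<exists>K. germ_vs.subspace K \<and> K \<subseteq> moderate \<and> C \<subset> K \<and> K \<subseteq> C_v \<union> {0})"

definition linearly_v_independent :: "germ set \<Rightarrow> bool" where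
  "linearly_v_independent \<Phi> \<longleftrightarrow> \<Phi> \<subseteq> moderate \<and> germ_vs.span \<Phi> \<subseteq> C_v \<union> {0}"

lift_definition germ_powr :: "real \<Rightarrow> germ" is "\<lambda>r x. complex_of_real (x powr r)" .

(* The term \<phi> / x^r; r = \<infinity> occurs only together with \<phi> = 0, where 0 / x^\<infinity> = 0. *)
definition series_term :: "germ \<Rightarrow> ereal \<Rightarrow> germ" where
  "series_term \<phi> r = (if r = \<infinity> then 0 else \<phi> * germ_powr (- real_of_ereal r))"

(* The exponents range over the reals together with \<infinity>, hence the exclusion of -\<infinity>. *)
definition v_asymptotic_series :: "(nat \<Rightarrow> germ) \<Rightarrow> (nat \<Rightarrow> ereal) \<Rightarrow> bool" where
  "v_asymptotic_series \<phi> r \<longleftrightarrow>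
     (\<forall>n. \<phi> n \<in> moderate) \<and> (\<forall>n. r n \<noteq> -\<infinity>) \<and>
     linearly_v_independent (range \<phi>) \<and>
     (\<forall>n. r n = \<infinity> \<longleftrightarrow> \<phi> n = 0) \<and>
     (\<forall>n. \<phi> n = 0 \<longleftrightarrow> (\<forall>m\<ge>n. \<phi> m = 0)) \<and>
     strict_mono_on {n. \<phi> n \<noteq> 0} r"

definition v_asymptotic_expansion :: "germ \<Rightarrow> (nat \<Rightarrow> germ) \<Rightarrow> (nat \<Rightarrow> ereal) \<Rightarrow> bool" where
  "v_asymptotic_expansion f \<phi> r \<longleftrightarrow>
     v_asymptotic_series \<phi> r \<and>
     (\<forall>n. \<phi> n \<noteq> 0 \<longrightarrow>
        germ_smallo (f - (\<Sum>k\<le>n. series_term (\<phi> k) (r k)))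
          (\<lambda>x. 1 / x powr real_of_ereal (r n))) \<and>
     (\<forall>n. \<phi> n = 0 \<longrightarrow> f - (\<Sum>k<n. series_term (\<phi> k) (r k)) \<in> negligible)"

end

theory Submission
  imports Defs
begin

text \<open>Let \<open>C\<close> be maximal in \<open>\<C>\<^sub>v\<close>. If \<open>v(f) = s\<close> is finite, then \<open>x\<^sup>s f\<close> has valuation \<open>0\<close>, and maximality
  yields \<open>\<phi> \<in> C\<close> with \<open>v(x\<^sup>s f - \<phi>) > 0\<close>; iterating on \<open>f - \<phi>/x\<^sup>s\<close> produces the expansion.
  Conversely, the condition \<open>f\<^sub>n - \<phi>\<^sub>n/x\<^bsup>r\<^sub>n\<^esup> = o(1/x\<^bsup>r\<^sub>n\<^esup>)\<close> on a single remainder does not determine \<open>\<phi>\<^sub>n\<close>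
  (\<open>C\<close> may contain \<open>1/ln x\<close>), but together with the condition on the next remainder it gives
  \<open>v(f\<^sub>n - \<phi>\<^sub>n/x\<^bsup>r\<^sub>n\<^esup>) > r\<^sub>n\<close>, which does. Maximal spaces exist by Zorn's lemma.\<close>

section \<open>Calculus of decay exponents\<close>

text \<open>Real exponents of either sign put O(x^n), O(1/x^n) and v on one scale: the set of all
  \<open>a\<close> with \<open>decays f a\<close> is closed downwards, and moderate growth,
  negligibility and v(f) can be read off from it.\<close>

definition decays :: "germ \<Rightarrow> real \<Rightarrow> bool" where
  "decays f a \<longleftrightarrow> germ_bigo f (\<lambda>x. 1 / x powr a)"

lemma powr_bigo_mono:
  assumes "b \<le> a"
  shows "(\<lambda>x. complex_of_real (1 / x powr a)) \<in> O[at_top](\<lambda>x. complex_of_real (1 / x powr b))"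
proof (rule landau_o.big_mono)
  show "\<forall>\<^sub>F x in at_top. norm (complex_of_real (1 / x powr a)) \<le> norm (complex_of_real (1 / x powr b))"
    using eventually_ge_at_top[of 1]
  proof eventually_elim
    case (elim x)
    then have "x powr b \<le> x powr a" using assms by (intro powr_mono) auto
    with elim show ?case by (simp add: norm_divide frac_le)
  qed
qed

lemma powr_smallo_mono:
  assumes "b < a"
  shows "(\<lambda>x. complex_of_real (1 / x powr a)) \<in> o[at_top](\<lambda>x. complex_of_real (1 / x powr b))"
proof (rule smalloI_tendsto)
  have "((\<lambda>x::real. x powr (b - a)) \<longlongrightarrow> 0) at_top"
    using assms by (intro tendsto_neg_powr filterlim_ident) auto
  then have "((\<lambda>x. complex_of_real (x powr (b - a))) \<longlongrightarrow> of_real 0) at_top"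
    by (rule tendsto_of_real)
  moreover have "\<forall>\<^sub>F x in at_top. complex_of_real (x powr (b - a)) =
      complex_of_real (1 / x powr a) / complex_of_real (1 / x powr b)"
    using eventually_gt_at_top[of 0]
    by eventually_elim (simp add: powr_diff)
  ultimately show "((\<lambda>x. complex_of_real (1 / x powr a) / complex_of_real (1 / x powr b)) \<longlongrightarrow> 0) at_top"
    by (simp cong: filterlim_cong)
  show "\<forall>\<^sub>F x in at_top. complex_of_real (1 / x powr b) \<noteq> 0"
    using eventually_gt_at_top[of 0] by eventually_elim simp
qed

lemma decays_mono: "decays f a \<Longrightarrow> b \<le> a \<Longrightarrow> decays f b"
  unfolding decays_def by transfer (blast intro: landau_o.big_trans powr_bigo_mono)

lemma decays_add: "decays f a \<Longrightarrow> decays g a \<Longrightarrow> decays (f + g) a"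
  unfolding decays_def by transfer (rule sum_in_bigo)

lemma decays_diff: "decays f a \<Longrightarrow> decays g a \<Longrightarrow> decays (f - g) a"
  unfolding decays_def by transfer (rule sum_in_bigo)

lemma decays_zero [simp]: "decays 0 a"
  unfolding decays_def by transfer simp

lemma decays_scale: "decays f a \<Longrightarrow> decays (germ_scale c f) a"
  unfolding decays_def germ_scale_def by transfer (cases "c = 0", auto)

lemma decays_scale_iff [simp]: "c \<noteq> 0 \<Longrightarrow> decays (germ_scale c f) a \<longleftrightarrow> decays f a"
  using decays_scale[of f a c] decays_scale[of "germ_scale c f" a "inverse c"] by auto

lemma germ_powr_add: "germ_powr a * germ_powr b = germ_powr (a + b)"
  by transfer (simp add: powr_add)

lemma germ_powr_zero: "germ_powr 0 = 1"
  by transfer (auto intro: eventually_mono[OF eventually_gt_at_top[of 0]])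

lemma germ_powr_cancel [simp]:
  "f * germ_powr a * germ_powr (- a) = f" "f * germ_powr (- a) * germ_powr a = f"
  by (simp_all add: mult.assoc germ_powr_add germ_powr_zero)

lemma decays_times_powr:
  assumes "decays f a"
  shows "decays (f * germ_powr b) (a - b)"
  using assms unfolding decays_def
proof transfer
  fix f :: "real \<Rightarrow> complex" and a b :: real
  assume "f \<in> O[at_top](\<lambda>x. complex_of_real (1 / x powr a))"
  then have "(\<lambda>x. f x * complex_of_real (x powr b)) \<in>
      O[at_top](\<lambda>x. complex_of_real (1 / x powr a) * complex_of_real (x powr b))"
    by (rule landau_o.big.mult) simp
  also have "\<forall>\<^sub>F x in at_top. complex_of_real (1 / x powr a) * complex_of_real (x powr b) =
      complex_of_real (1 / x powr (a - b))"
    using eventually_gt_at_top[of 0] by eventually_elim (simp add: powr_diff)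
  finally show "(\<lambda>x. f x * complex_of_real (x powr b)) \<in> O[at_top](\<lambda>x. complex_of_real (1 / x powr (a - b)))" .
qed

text \<open>Multiplication by x^b is invertible on germs, with inverse multiplication by x^(-b), so
  the one-sided shift of exponents applies in both directions.\<close>

lemma decays_times_powr_iff: "decays (f * germ_powr b) a \<longleftrightarrow> decays f (a + b)"
  using decays_times_powr[of f "a + b" b] decays_times_powr[of "f * germ_powr b" a "- b"] by auto

lemma smallo_imp_decays: "germ_smallo f (\<lambda>x. 1 / x powr a) \<Longrightarrow> decays f a"
  unfolding decays_def by transfer (rule landau_o.small_imp_big)

text \<open>Passing from O to o costs a strict loss in the exponent, since 1/x^a is not o of
  itself.\<close>

lemma decays_imp_smallo: "decays f a \<Longrightarrow> b < a \<Longrightarrow> germ_smallo f (\<lambda>x. 1 / x powr b)"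
  unfolding decays_def by transfer (blast intro: landau_o.big_small_trans powr_smallo_mono)

lemma germ_bigo_cong:
  assumes "\<forall>\<^sub>F x in at_top. g x = h x"
  shows "germ_bigo f g \<longleftrightarrow> germ_bigo f h"
  using assms
proof transfer
  fix f and g h :: "real \<Rightarrow> real"
  assume "\<forall>\<^sub>F x in at_top. g x = h x"
  then show "(f \<in> O[at_top](\<lambda>x. complex_of_real (g x))) = (f \<in> O[at_top](\<lambda>x. complex_of_real (h x)))"
    using landau_o.big.cong[of "\<lambda>x. complex_of_real (g x)" "\<lambda>x. complex_of_real (h x)" at_top]
    by (auto elim: eventually_mono)
qed

section \<open>Moderate and negligible germs in terms of decay exponents\<close>

lemma germ_bigo_power_iff: "germ_bigo f (\<lambda>x. x ^ n) \<longleftrightarrow> decays f (- real n)"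
  unfolding decays_def
  by (intro germ_bigo_cong eventually_mono[OF eventually_gt_at_top[of 0]])
    (simp add: powr_minus powr_realpow field_simps)

lemma germ_bigo_inverse_power_iff: "germ_bigo f (\<lambda>x. 1 / x ^ n) \<longleftrightarrow> decays f (real n)"
  unfolding decays_def
  by (intro germ_bigo_cong eventually_mono[OF eventually_gt_at_top[of 0]])
    (simp add: powr_realpow)

lemma moderate_iff: "f \<in> moderate \<longleftrightarrow> (\<exists>a. decays f a)"
proof
  assume "\<exists>a. decays f a"
  then obtain a where a: "decays f a" by blast
  obtain n :: nat where "- a \<le> real n" using real_arch_simple by blast
  then have "decays f (- real n)" using a decays_mono by (metis minus_le_iff)
  then show "f \<in> moderate" unfolding moderate_def by (auto simp: germ_bigo_power_iff)
qed (auto simp: moderate_def germ_bigo_power_iff)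

lemma negligible_iff: "f \<in> negligible \<longleftrightarrow> (\<forall>a. decays f a)"
proof
  assume f: "f \<in> negligible"
  show "\<forall>a. decays f a"
  proof
    fix a :: real
    obtain n :: nat where "a \<le> real n" using real_arch_simple by blast
    moreover have "decays f (real n)"
      using f by (simp add: negligible_def germ_bigo_inverse_power_iff)
    ultimately show "decays f a" by (rule decays_mono[rotated])
  qed
qed (auto simp: negligible_def germ_bigo_inverse_power_iff)

lemma moderate_diff: "f \<in> moderate \<Longrightarrow> g \<in> moderate \<Longrightarrow> f - g \<in> moderate"
  unfolding moderate_iff by (metis decays_diff decays_mono linear)

lemma moderate_times_powr: "f \<in> moderate \<Longrightarrow> f * germ_powr b \<in> moderate"
  unfolding moderate_iff by (blast intro: decays_times_powr)

section \<open>The valuation and the set \<open>C_v\<close>\<close>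

lemma val_v_altdef: "val_v f = Sup (ereal ` {a. decays f a})"
  by (simp add: val_v_def decays_def)

lemma decays_imp_le_val_v: "decays f a \<Longrightarrow> ereal a \<le> val_v f"
  unfolding val_v_altdef by (intro Sup_upper) auto

lemma less_val_v_imp_decays: "ereal a < val_v f \<Longrightarrow> decays f a"
  unfolding val_v_altdef less_Sup_iff by (auto dest: decays_mono[OF _ less_imp_le])

text \<open>The value \<infinity> would mean decay at every real exponent, the value -\<infinity>
  decay at none.\<close>

lemma val_v_real:
  assumes "f \<in> moderate" "f \<notin> negligible"
  obtains s where "val_v f = ereal s"
proof (cases "val_v f")
  case PInf
  then show ?thesis using assms(2) by (auto simp: negligible_iff intro: less_val_v_imp_decays)
next
  case MInf
  then show ?thesis using assms(1) by (auto simp: moderate_iff dest: decays_imp_le_val_v)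
qed

text \<open>Nothing is asserted at \<open>s\<close> itself because the supremum need not be
  attained: ln x has valuation 0 but is not O(1).\<close>

lemma val_v_eq_iff:
  "val_v f = ereal s \<longleftrightarrow> (\<forall>a<s. decays f a) \<and> (\<forall>a>s. \<not> decays f a)" (is "_ \<longleftrightarrow> ?R")
proof
  assume "val_v f = ereal s"
  then show ?R
    using less_val_v_imp_decays[of _ f] decays_imp_le_val_v[of f] by fastforce
next
  assume R: ?R
  show "val_v f = ereal s"
  proof (rule antisym)
    show "val_v f \<le> ereal s"
      unfolding val_v_altdef by (rule Sup_least) (use R in \<open>auto intro: leI\<close>)
    show "ereal s \<le> val_v f"
      by (rule dense_le) (metis R decays_imp_le_val_v ereal_less_eq(2) ereal_less_ereal_Ex less_ereal.simps(1) linorder_not_less order_less_imp_le)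
  qed
qed

lemma C_v_iff: "f \<in> C_v \<longleftrightarrow> (\<forall>a<0. decays f a) \<and> (\<forall>a>0. \<not> decays f a)"
proof -
  have "f \<in> moderate" if "\<forall>a<0. decays f a"
    unfolding moderate_iff using that[rule_format, of "-1"] by auto
  then show ?thesis unfolding C_v_def using val_v_eq_iff[of f 0] by (auto simp: zero_ereal_def)
qed

lemma zero_notin_C_v: "0 \<notin> C_v"
  unfolding C_v_iff using zero_less_one by (metis decays_zero)

lemma scale_in_C_v: "f \<in> C_v \<Longrightarrow> c \<noteq> 0 \<Longrightarrow> germ_scale c f \<in> C_v"
  by (simp add: C_v_iff)

lemma germ_const_in_C_v:
  assumes "c \<noteq> 0"
  shows "germ_const c \<in> C_v"
proof -
  have eq: "germ_const c = germ_scale c 1" by (simp add: germ_scale_def)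
  have "decays 1 0"
    unfolding decays_def
  proof transfer
    show "(\<lambda>x. 1) \<in> O[at_top](\<lambda>x. complex_of_real (1 / x powr 0))"
      by (rule landau_o.big_mono) (auto intro: eventually_mono[OF eventually_gt_at_top[of 0]])
  qed
  moreover have "\<not> decays 1 a" if "a > 0" for a
  proof
    assume "decays 1 a"
    \<comment> \<open>A positive exponent would make the constant 1 a little-o of itself.\<close>
    then have "germ_smallo 1 (\<lambda>x. 1 / x powr 0)" using that by (rule decays_imp_smallo)
    then show False
    proof transfer
      assume "(\<lambda>x. 1) \<in> o[at_top](\<lambda>x. complex_of_real (1 / x powr 0))"
      also have "\<forall>\<^sub>F x in at_top. complex_of_real (1 / x powr 0) = 1"
        by (auto intro: eventually_mono[OF eventually_gt_at_top[of 0]])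
      finally show False by (simp add: landau_o.small_refl_iff)
    qed
  qed
  ultimately have "(1::germ) \<in> C_v" using decays_mono[of 1 0] by (auto simp: C_v_iff)
  then show ?thesis unfolding eq using assms by (rule scale_in_C_v)
qed

section \<open>Leading terms: existence and uniqueness\<close>

text \<open>The gap \<open>s < a\<close> encodes v(f - \<phi>/x^s) > s. A bare o(1/x^s) would be
  weaker and would not determine \<phi>. The first disjunct is the terminated series, with its
  convention 0/x^\<infinity> = 0.\<close>

definition leading_term :: "germ set \<Rightarrow> germ \<Rightarrow> germ \<Rightarrow> ereal \<Rightarrow> bool" where
  "leading_term C f \<phi> r \<longleftrightarrow>
     f \<in> negligible \<and> \<phi> = 0 \<and> r = \<infinity> \<or>
     (\<exists>s a. r = ereal s \<and> \<phi> \<in> C - {0} \<and> s < a \<and> decays (f - \<phi> * germ_powr (- s)) a)"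

lemma leading_term_exists:
  assumes C: "maximal_in_C_v C" and f: "f \<in> moderate"
  shows "\<exists>\<phi> r. leading_term C f \<phi> r"
proof (cases "f \<in> negligible")
  case True
  then show ?thesis by (auto simp: leading_term_def)
next
  case False
  then obtain s where s: "val_v f = ereal s" using val_v_real[OF f] by blast
  \<comment> \<open>Multiplying by x^s moves the valuation from \<open>s\<close> to 0, where the
    maximality of \<open>C\<close> applies.\<close>
  define g where "g = f * germ_powr s"
  have g: "g \<in> C_v"
    using s unfolding C_v_iff val_v_eq_iff g_def decays_times_powr_iff
    by (smt (verit))
  then have g0: "g \<noteq> 0" using zero_notin_C_v by auto
  have sub: "germ_vs.subspace C" and C_v: "C \<subseteq> C_v \<union> {0}"
    using C by (auto simp: maximal_in_C_v_def)
  have "\<exists>\<phi>\<in>C - {0}. \<exists>a>0. decays (g - \<phi>) a"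
  proof (cases "g \<in> C")
    case True
    \<comment> \<open>The choice \<phi> = \<open>g\<close> leaves remainder 0, which decays at every
      exponent; 1 is just a positive one.\<close>
    then show ?thesis using g0 zero_less_one[where 'a = real] by (intro bexI[of _ g]) (auto intro!: exI[of _ 1])
  next
    case False
    let ?K = "germ_vs.span (insert g C)"
    have K: "germ_vs.subspace ?K" "C \<subset> ?K"
      using False germ_vs.span_superset[of "insert g C"] by auto
    \<comment> \<open>Adjoining \<open>g\<close> enlarges \<open>C\<close> strictly, so maximality
      forces some nonzero \<open>h\<close> in the span out of \<open>C_v\<close>.\<close>
    have "\<not> ?K \<subseteq> C_v \<union> {0}"
    proof
      assume K': "?K \<subseteq> C_v \<union> {0}"
      moreover have "C_v \<union> {0} \<subseteq> moderate" by (auto simp: C_v_def moderate_iff)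
      ultimately have "?K \<subseteq> moderate" by (rule subset_trans)
      then show False using K K' C unfolding maximal_in_C_v_def by metis
    qed
    then obtain h where h: "h \<in> ?K" "h \<notin> C_v" "h \<noteq> 0" by blast
    then obtain k where k: "h - germ_scale k g \<in> C"
      using germ_vs.span_breakdown_eq[of h g C] sub germ_vs.span_eq_iff[THEN iffD2] by metis
    have k0: "k \<noteq> 0" using k h C_v by auto
    \<comment> \<open>Write \<open>h\<close> = k g + c with c in \<open>C\<close> and solve for
      \<open>g\<close>: \<phi> = -c/k lies in \<open>C\<close>, and g - \<phi> = h/k is outside
      \<open>C_v\<close> because \<open>h\<close> is.\<close>
    define \<phi> where "\<phi> = germ_scale (- inverse k) (h - germ_scale k g)"
    have \<phi>: "\<phi> \<in> C" unfolding \<phi>_def using sub k by (rule germ_vs.subspace_scale)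
    have eq: "g - \<phi> = germ_scale (inverse k) h"
      using k0 by (simp add: \<phi>_def germ_vs.scale_right_diff_distrib)
    have nC: "g - \<phi> \<notin> C_v"
      using scale_in_C_v[of "g - \<phi>" k] h(2) k0 by (auto simp: eq)
    then have "\<phi> \<noteq> 0" using g by auto
    then have "\<phi> \<in> C_v" using \<phi> C_v by auto
    \<comment> \<open>Both \<open>g\<close> and \<phi> decay at all negative exponents, so their
      difference can fail to be in \<open>C_v\<close> only by decaying at a positive one.\<close>
    then have "\<forall>a<0. decays (g - \<phi>) a" using g by (auto simp: C_v_iff intro: decays_diff)
    with nC have "\<exists>a>0. decays (g - \<phi>) a" by (auto simp: C_v_iff)
    then show ?thesis using \<phi> \<open>\<phi> \<noteq> 0\<close> by blast
  qed
  then obtain \<phi> a where *: "\<phi> \<in> C - {0}" "a > 0" "decays (g - \<phi>) a" by blast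
  have "f - \<phi> * germ_powr (- s) = (g - \<phi>) * germ_powr (- s)"
    by (simp add: g_def left_diff_distrib)
  then have "decays (f - \<phi> * germ_powr (- s)) (a + s)"
    using * by (simp add: decays_times_powr_iff)
  then have "leading_term C f \<phi> (ereal s)" unfolding leading_term_def using *
    by (intro disjI2 exI[of _ s] exI[of _ "a + s"]) auto
  then show ?thesis by blast
qed

text \<open>Otherwise \<phi>/x^s, as a difference of two germs decaying beyond \<open>s\<close>,
  would itself decay beyond \<open>s\<close>, against v(\<phi>) = 0.\<close>

lemma not_decays_beyond:
  assumes "\<phi> \<in> C_v" "s < a" "decays (f - \<phi> * germ_powr (- s)) a" "s < b"
  shows "\<not> decays f b"
proof
  assume "decays f b"
  then have "decays f (min a b)" by (rule decays_mono) simp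
  then have "decays (f - (f - \<phi> * germ_powr (- s))) (min a b)"
    by (rule decays_diff[OF _ decays_mono[OF assms(3)]]) simp
  then have "decays \<phi> (min a b - s)" by (simp add: decays_times_powr_iff)
  moreover have "min a b - s > 0" using assms by auto
  ultimately show False using assms(1) by (auto simp: C_v_iff)
qed

text \<open>Here the remainder is only assumed to decay at \<open>s\<close> itself, which is what a
  little-o bound supplies.\<close>

lemma decays_before:
  assumes "\<phi> \<in> C_v" "decays (f - \<phi> * germ_powr (- s)) s" "b < s"
  shows "decays f b"
proof -
  have "decays (\<phi> * germ_powr (- s)) b"
    using assms by (auto simp: decays_times_powr_iff C_v_iff)
  moreover have "decays (f - \<phi> * germ_powr (- s)) b" using assms by (intro decays_mono[OF assms(2)]) simp
  ultimately show ?thesis using decays_add by fastforce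
qed

text \<open>For non-negligible \<open>f\<close>, the two preceding bounds force both exponents to
  agree. Subtracting the two remainders then makes \<phi> - \<psi> decay at a positive exponent, and
  0 is the only such element of \<open>C\<close>.\<close>

lemma leading_term_unique:
  assumes sub: "germ_vs.subspace C" and C_v: "C \<subseteq> C_v \<union> {0}"
    and 1: "leading_term C f \<phi> r" and 2: "leading_term C f \<psi> t"
  shows "\<phi> = \<psi> \<and> r = t"
proof -
  have not_negl: "\<phi>' = 0 \<and> r' = \<infinity>" if "leading_term C f \<phi>' r'" "f \<in> negligible" for \<phi>' r'
    using that C_v not_decays_beyond unfolding leading_term_def negligible_iff by blast
  show ?thesis
  proof (cases "f \<in> negligible")
    case True
    then show ?thesis using not_negl 1 2 by blast
  next
    case False
    obtain s a where s: "r = ereal s" "\<phi> \<in> C" "\<phi> \<in> C_v" "s < a" "decays (f - \<phi> * germ_powr (- s)) a"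
      using 1 False C_v unfolding leading_term_def by blast
    obtain u b where u: "t = ereal u" "\<psi> \<in> C" "\<psi> \<in> C_v" "u < b" "decays (f - \<psi> * germ_powr (- u)) b"
      using 2 False C_v unfolding leading_term_def by blast
    \<comment> \<open>Stated for generic data so that it can be used with the two leading terms in
      either order. An exponent strictly between u' and s' would be both attained and excluded by
      \<open>f\<close>.\<close>
    have le: "s' \<le> u'" if "\<phi>' \<in> C_v" "\<psi>' \<in> C_v" "s' < a'" "decays (f - \<phi>' * germ_powr (- s')) a'"
       "u' < b'" "decays (f - \<psi>' * germ_powr (- u')) b'" for \<phi>' \<psi>' s' u' a' b'
    proof (rule ccontr)
      assume "\<not> s' \<le> u'"
      then obtain c where c: "u' < c" "c < s'" using dense[of u' s'] by (auto simp: not_le)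
      have "decays f c"
        using decays_before[OF that(1) decays_mono[OF that(4)] c(2)] that(3) by simp
      then show False using not_decays_beyond[OF that(2,5,6) c(1)] by blast
    qed
    have su: "s = u" using le[of \<phi> \<psi> s a u b] le[of \<psi> \<phi> u b s a] s u by auto
    have "decays ((f - \<psi> * germ_powr (- u)) - (f - \<phi> * germ_powr (- s))) (min a b)"
      by (rule decays_diff[OF decays_mono[OF u(5)] decays_mono[OF s(5)]]) simp_all
    then have "decays ((\<phi> - \<psi>) * germ_powr (- s)) (min a b)"
      by (simp add: su algebra_simps)
    then have "decays (\<phi> - \<psi>) (min a b - s)" by (simp add: decays_times_powr_iff)
    moreover have "min a b - s > 0" using s u su by auto
    ultimately have "\<phi> - \<psi> \<notin> C_v" by (auto simp: C_v_iff)
    then have "\<phi> - \<psi> = 0" using germ_vs.subspace_diff[OF sub s(2) u(2)] C_v by auto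
    then show ?thesis using su s(1) u(1) by simp
  qed
qed

section \<open>Expansions as sequences of leading terms\<close>

lemma expansion_imp_leading_terms:
  assumes C_v: "C \<subseteq> C_v \<union> {0}" and \<phi>: "\<And>n. \<phi> n \<in> C"
    and exp: "v_asymptotic_expansion f \<phi> r"
  shows "leading_term C (f - (\<Sum>k<n. series_term (\<phi> k) (r k))) (\<phi> n) (r n)"
proof -
  let ?R = "\<lambda>n. f - (\<Sum>k<n. series_term (\<phi> k) (r k))"
  have ser: "v_asymptotic_series \<phi> r" using exp by (simp add: v_asymptotic_expansion_def)
  then have \<phi>0: "r n = \<infinity> \<longleftrightarrow> \<phi> n = 0" and r_nm: "r n \<noteq> -\<infinity>" for n
    unfolding v_asymptotic_series_def by blast+
  have real_r: "\<exists>s. r n = ereal s" if "\<phi> n \<noteq> 0" for n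
    using \<phi>0[of n] r_nm[of n] that by (cases "r n") auto
  have step: "?R (Suc n) = ?R n - \<phi> n * germ_powr (- s)" if "r n = ereal s" for n s
    using that by (simp add: series_term_def)
  have small: "decays (?R (Suc n)) s" if "\<phi> n \<noteq> 0" "r n = ereal s" for n s
    using exp that unfolding v_asymptotic_expansion_def lessThan_Suc_atMost
    by (metis real_of_ereal.simps(1) smallo_imp_decays)
  have negl: "?R n \<in> negligible" if "\<phi> n = 0" for n
    using exp that by (simp add: v_asymptotic_expansion_def)
  show ?thesis
  proof (cases "\<phi> n = 0")
    case True
    then show ?thesis using negl \<phi>0 by (simp add: leading_term_def)
  next
    case False
    then obtain s where s: "r n = ereal s" using real_r by blast
    \<comment> \<open>The bound at index \<open>n\<close> gives decay at \<open>s\<close> only; the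
      strict gain comes from index \<open>Suc n\<close>, where the remainder is either negligible or
      starts at a larger exponent \<open>t\<close>.\<close>
    have "\<exists>a>s. decays (?R (Suc n)) a"
    proof (cases "\<phi> (Suc n) = 0")
      case True
      then show ?thesis using negl[OF True] gt_ex[of s] unfolding negligible_iff by blast
    next
      case False': False
      then obtain t where t: "r (Suc n) = ereal t" using real_r by blast
      have "s < t"
        using ser False False' s t unfolding v_asymptotic_series_def strict_mono_on_def
        by (metis (mono_tags, lifting) less_ereal.simps(1) lessI mem_Collect_eq)
      \<comment> \<open>The exponent must stay below \<open>t\<close>, since a coefficient in
        \<open>C_v\<close> may be unbounded.\<close>
      then obtain a where "s < a" "a < t" using dense by blast
      moreover have "decays (?R (Suc n) - \<phi> (Suc n) * germ_powr (- t)) t"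
        using small[OF False' t] unfolding step[OF t] .
      moreover have "\<phi> (Suc n) \<in> C_v" using \<phi>[of "Suc n"] C_v False' by blast
      ultimately show ?thesis using decays_before by blast
    qed
    then show ?thesis using False \<phi>[of n] s unfolding step[OF s] leading_term_def by blast
  qed
qed

text \<open>Termination and increasing exponents follow from the remainders: a negligible one can
  only have leading coefficient 0, and one decaying beyond \<open>s\<close> can only start beyond
  \<open>s\<close>.\<close>

lemma leading_terms_imp_expansion:
  assumes sub: "germ_vs.subspace C" and C_v: "C \<subseteq> C_v \<union> {0}"
    and lead: "\<And>n. leading_term C (f - (\<Sum>k<n. series_term (\<phi> k) (r k))) (\<phi> n) (r n)"
  shows "v_asymptotic_expansion f \<phi> r \<and> (\<forall>n. \<phi> n \<in> C)"
proof -
  let ?R = "\<lambda>n. f - (\<Sum>k<n. series_term (\<phi> k) (r k))"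
  have step: "?R (Suc n) = ?R n - \<phi> n * germ_powr (- s)" if "r n = ereal s" for n s
    using that by (simp add: series_term_def)
  have \<phi>: "\<phi> n \<in> C" for n
    using lead[of n] germ_vs.subspace_0[OF sub] by (auto simp: leading_term_def)
  have \<phi>0: "\<phi> n = 0 \<longleftrightarrow> r n = \<infinity>" and r_nm: "r n \<noteq> -\<infinity>" for n
    using lead[of n] by (auto simp: leading_term_def)
  have negl: "?R n \<in> negligible" if "\<phi> n = 0" for n
    using lead[of n] that by (auto simp: leading_term_def)
  have pos: "\<exists>s a. r n = ereal s \<and> \<phi> n \<in> C_v \<and> s < a \<and> decays (?R (Suc n)) a" if "\<phi> n \<noteq> 0" for n
    using lead[of n] that C_v step unfolding leading_term_def by (metis (no_types, lifting) Diff_iff Un_iff subsetD)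
  \<comment> \<open>A zero coefficient contributes the term 0, so the next remainder is the same
    negligible germ.\<close>
  have zero_Suc: "\<phi> (Suc n) = 0" if "\<phi> n = 0" for n
  proof (rule ccontr)
    assume "\<phi> (Suc n) \<noteq> 0"
    then obtain s a where s: "r (Suc n) = ereal s" "\<phi> (Suc n) \<in> C_v" "s < a" "decays (?R (Suc (Suc n))) a"
      using pos[of "Suc n"] by blast
    have "\<not> decays (?R (Suc n)) (s + 1)"
      using s(4) unfolding step[OF s(1)] by (rule not_decays_beyond[OF s(2,3)]) simp
    moreover have "?R (Suc n) = ?R n" using that \<phi>0 by (simp add: series_term_def)
    ultimately show False
      using negl[OF that] unfolding negligible_iff by metis
  qed
  have zero: "\<phi> m = 0" if "\<phi> n = 0" "n \<le> m" for n m
    using that(2,1) by (induction rule: dec_induct) (auto intro: zero_Suc)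
  have less_Suc: "r n < r (Suc n)" if nz: "\<phi> (Suc n) \<noteq> 0" for n
  proof -
    have "\<phi> n \<noteq> 0" using nz zero_Suc[of n] by blast
    then obtain s a where s: "r n = ereal s" "s < a" "decays (?R (Suc n)) a"
      using pos[of n] by blast
    obtain t b where t: "r (Suc n) = ereal t" "\<phi> (Suc n) \<in> C_v" "t < b" "decays (?R (Suc (Suc n))) b"
      using pos[OF nz] by blast
    \<comment> \<open>The remainder decays at \<open>a\<close>, whereas its leading exponent
      \<open>t\<close> excludes decay beyond \<open>t\<close>; hence s < a \<le> t.\<close>
    have "\<not> t < a"
      using not_decays_beyond[OF t(2,3) t(4)[unfolded step[OF t(1)]]] s(3) by blast
    then show ?thesis using s t by simp
  qed
  \<comment> \<open>The induction descends from \<open>n\<close>, because nonvanishing of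
    coefficients passes to smaller indices.\<close>
  have less: "r m < r n" if "m < n" "\<phi> n \<noteq> 0" for m n
    using that
  proof (induction rule: strict_inc_induct)
    case (base i)
    then show ?case using less_Suc by simp
  next
    case (step i)
    have "\<phi> (Suc i) \<noteq> 0" using zero[of "Suc i" n] step by auto
    then show ?case using less_Suc[of i] step by (auto intro: less_trans)
  qed
  \<comment> \<open>Linear v-independence is inherited from \<open>C\<close>, which contains the
    whole span.\<close>
  have "germ_vs.span (range \<phi>) \<subseteq> C" using \<phi> sub by (intro germ_vs.span_minimal) auto
  then have indep: "linearly_v_independent (range \<phi>)"
    using C_v \<phi> unfolding linearly_v_independent_def C_v_def moderate_iff
    by (force simp: moderate_iff)
  then have "v_asymptotic_series \<phi> r"
    unfolding v_asymptotic_series_def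
  proof (intro conjI allI)
    show "\<phi> n \<in> moderate" for n using indep by (auto simp: linearly_v_independent_def)
    show "\<phi> n = 0 \<longleftrightarrow> (\<forall>m\<ge>n. \<phi> m = 0)" for n using zero by blast
    show "strict_mono_on {n. \<phi> n \<noteq> 0} r" using less by (auto intro: strict_mono_onI)
  qed (use r_nm \<phi>0 in blast)+
  moreover have "germ_smallo (f - (\<Sum>k\<le>n. series_term (\<phi> k) (r k)))
          (\<lambda>x. 1 / x powr real_of_ereal (r n))" if "\<phi> n \<noteq> 0" for n
    using pos[OF that] decays_imp_smallo by (auto simp flip: lessThan_Suc_atMost simp del: sum.lessThan_Suc)
  ultimately show ?thesis using \<phi> negl unfolding v_asymptotic_expansion_def by blast
qed

section \<open>Existence and uniqueness of the expansion in a maximal space\<close>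

lemma expansion_exists:
  assumes C: "maximal_in_C_v C" and f: "f \<in> moderate"
  shows "\<exists>\<phi> r. v_asymptotic_expansion f \<phi> r \<and> (\<forall>n. \<phi> n \<in> C)"
proof -
  have sub: "germ_vs.subspace C" and C_v: "C \<subseteq> C_v \<union> {0}" and mod: "C \<subseteq> moderate"
    using C by (auto simp: maximal_in_C_v_def)
  \<comment> \<open>\<open>T\<close> selects a leading term and is specified on moderate germs only,
    so the iteration must be shown to stay among them.\<close>
  obtain T where T: "\<And>g. g \<in> moderate \<Longrightarrow> leading_term C g (fst (T g)) (snd (T g))"
  proof -
    have "\<forall>g. \<exists>p. g \<in> moderate \<longrightarrow> leading_term C g (fst p) (snd p)"
      using leading_term_exists[OF C] by (metis fst_conv snd_conv)
    from choice[OF this] show ?thesis using that by blast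
  qed
  define next_rem where "next_rem g = g - series_term (fst (T g)) (snd (T g))" for g
  define R where "R n = (next_rem ^^ n) f" for n
  define \<phi> where "\<phi> n = fst (T (R n))" for n
  define r where "r n = snd (T (R n))" for n
  have R_mod: "R n \<in> moderate" for n
  proof (induction n)
    case 0
    then show ?case using f by (simp add: R_def)
  next
    case (Suc n)
    have "fst (T (R n)) \<in> moderate"
      using T[OF Suc] mod
      by (auto simp: leading_term_def moderate_iff)
    then have "series_term (fst (T (R n))) (snd (T (R n))) \<in> moderate"
      by (auto simp: series_term_def moderate_times_powr) (auto simp: moderate_iff)
    then show ?case using Suc by (simp add: R_def next_rem_def moderate_diff)
  qed
  have R_eq: "R n = f - (\<Sum>k<n. series_term (\<phi> k) (r k))" for n
  proof (induction n)
    case (Suc n)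
    have "R (Suc n) = R n - series_term (\<phi> n) (r n)"
      by (simp add: R_def next_rem_def \<phi>_def r_def)
    then show ?case using Suc by simp
  qed (simp add: R_def)
  have "leading_term C (f - (\<Sum>k<n. series_term (\<phi> k) (r k))) (\<phi> n) (r n)" for n
    using T[OF R_mod[of n], folded \<phi>_def r_def] unfolding R_eq .
  then show ?thesis using leading_terms_imp_expansion[OF sub C_v] by blast
qed

text \<open>Equal earlier terms give equal remainders, and each pair of entries is the unique
  leading term of its remainder.\<close>

lemma expansion_unique:
  assumes sub: "germ_vs.subspace C" and C_v: "C \<subseteq> C_v \<union> {0}"
    and 1: "v_asymptotic_expansion f \<phi> r" "\<And>n. \<phi> n \<in> C"
    and 2: "v_asymptotic_expansion f \<psi> t" "\<And>n. \<psi> n \<in> C"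
  shows "\<phi> = \<psi> \<and> r = t"
proof -
  have "\<phi> n = \<psi> n \<and> r n = t n" for n
  proof (induction n rule: less_induct)
    case (less n)
    then have "(\<Sum>k<n. series_term (\<phi> k) (r k)) = (\<Sum>k<n. series_term (\<psi> k) (t k))" by simp
    then show ?case
      using leading_term_unique[OF sub C_v] expansion_imp_leading_terms[OF C_v 1(2) 1(1)]
        expansion_imp_leading_terms[OF C_v 2(2) 2(1)] by metis
  qed
  then show ?thesis by auto
qed

section \<open>Existence of maximal spaces by Zorn's lemma\<close>

lemma maximal_in_C_v_exists: "\<exists>C. maximal_in_C_v C"
proof -
  define A where "A = {K. germ_vs.subspace K \<and> range germ_const \<subseteq> K \<and> K \<subseteq> C_v \<union> {0}}"
  \<comment> \<open>Constants are the multiples of 1, so they form a subspace and make the family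
    \<open>A\<close> nonempty.\<close>
  have "range germ_const = germ_vs.span {1}"
    unfolding germ_vs.span_singleton germ_scale_def by simp
  then have "germ_vs.subspace (range germ_const)" by simp
  moreover have "range germ_const \<subseteq> C_v \<union> {0}"
  proof -
    have "germ_const 0 = 0" by transfer simp
    then show ?thesis using germ_const_in_C_v by (metis UnI1 UnI2 image_subsetI singletonI)
  qed
  ultimately have "range germ_const \<in> A" by (auto simp: A_def)
  moreover have "\<Union>\<C> \<in> A" if ne: "\<C> \<noteq> {}" and chain: "subset.chain A \<C>" for \<C>
  proof -
    have sub: "K \<in> \<C> \<Longrightarrow> germ_vs.subspace K" for K
      using chain by (auto simp: subset_chain_def A_def)
    have "germ_vs.subspace (\<Union>\<C>)"
    proof (rule germ_vs.subspaceI)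
      show "0 \<in> \<Union>\<C>" using ne sub germ_vs.subspace_0 by blast
    next
      fix f g assume "f \<in> \<Union>\<C>" "g \<in> \<Union>\<C>"
      then obtain K L where "K \<in> \<C>" "L \<in> \<C>" "f \<in> K" "g \<in> L" by blast
      \<comment> \<open>Two members of a chain are comparable, so both summands lie in the larger
        one.\<close>
      moreover then have "K \<subseteq> L \<or> L \<subseteq> K" using chain by (auto simp: subset_chain_def)
      ultimately show "f + g \<in> \<Union>\<C>" using sub germ_vs.subspace_add by blast
    next
      fix c f assume "f \<in> \<Union>\<C>"
      then show "germ_scale c f \<in> \<Union>\<C>" using sub germ_vs.subspace_scale by blast
    qed
    then show ?thesis using ne chain by (fastforce simp: A_def subset_chain_def)
  qed
  ultimately obtain C where C: "C \<in> A" "\<forall>K\<in>A. C \<subseteq> K \<longrightarrow> K = C"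
    using subset_Zorn_nonempty[of A] by blast
  have "C_v \<union> {0} \<subseteq> moderate" by (auto simp: C_v_def moderate_iff)
  moreover have props: "germ_vs.subspace C" "range germ_const \<subseteq> C" "C \<subseteq> C_v \<union> {0}"
    using C(1) by (simp_all add: A_def)
  moreover have False if K: "germ_vs.subspace K" "C \<subset> K" "K \<subseteq> C_v \<union> {0}" for K
  proof -
    have "K \<in> A" using K props(2) unfolding A_def by blast
    then show False using C(2) K(2) by blast
  qed
  ultimately have "maximal_in_C_v C"
    unfolding maximal_in_C_v_def by (metis subset_trans)
  then show ?thesis ..
qed

theorem theorem8:
  shows "(\<forall>f\<in>moderate. \<exists>\<phi> r. v_asymptotic_expansion f \<phi> r) \<and>
    (\<forall>C. maximal_in_C_v C \<longrightarrow>
      (\<forall>f\<in>moderate. \<exists>!(\<phi>, r). v_asymptotic_expansion f \<phi> r \<and> (\<forall>n. \<phi> n \<in> C)))"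
proof (intro conjI ballI allI impI)
  fix f assume "f \<in> moderate"
  then show "\<exists>\<phi> r. v_asymptotic_expansion f \<phi> r"
    using maximal_in_C_v_exists expansion_exists by blast
next
  fix C f assume C: "maximal_in_C_v C" and f: "f \<in> moderate"
  then have "germ_vs.subspace C" "C \<subseteq> C_v \<union> {0}" by (auto simp: maximal_in_C_v_def)
  then show "\<exists>!(\<phi>, r). v_asymptotic_expansion f \<phi> r \<and> (\<forall>n. \<phi> n \<in> C)"
    using expansion_exists[OF C f] expansion_unique[of C f] by auto
qed

end
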